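(* The corner points (extreme points) of the convex set $S$ are exactly the following points together with those obtained from them by qutrit permutations: $$[O,O,O],\ [O,A,A],\ [O,B,B],\ [A,A,A],\ [A,A,B],\ [A,B,B],\ [B,B,B],$$ $$\left[B,\,0\tfrac13\tfrac23,\,0\tfrac13\tfrac23\right],\ \left[A,\,0\tfrac14\tfrac34,\,\tfrac14\tfrac14\tfrac12\right],\ \left[A,\,B,\,\tfrac16\tfrac16\tfrac23\right],\ \left[A,\,\tfrac16\tfrac16\tfrac23,\,\tfrac16\tfrac16\tfrac23\right].$$
   Context: Let $S$ be the set of all nine-tuples of nonnegative real numbers $\lambda_i^{(a)}$ ($i=1,2,3$, $a=1,2,3$) with $\lambda_1^{(a)}\le\lambda_2^{(a)}\le\lambda_3^{(a)}$ and $\lambda_1^{(a)}+\lambda_2^{(a)}+\lambda_3^{(a)}=1$ for each $a$ which satisfy, for every permutation $(a,b,c)$ of $(1,2,3)$, the inequalities (1) $\lambda_2^{(a)}+\lambda_1^{(a)}\le\lambda_2^{(b)}+\lambda_1^{(b)}+\lambda_2^{(c)}+\lambda_1^{(c)}$; (2) $\lambda_3^{(a)}+\lambda_1^{(a)}\le\lambda_2^{(b)}+\lambda_1^{(b)}+\lambda_3^{(c)}+\lambda_1^{(c)}$; (3) $\lambda_2^{(a)}+\lambda_3^{(a)}\le\lambda_2^{(b)}+\lambda_1^{(b)}+\lambda_2^{(c)}+\lambda_3^{(c)}$; (4) $2\lambda_2^{(a)}+\lambda_1^{(a)}\le2\lambda_2^{(b)}+\lambda_1^{(b)}+2\lambda_2^{(c)}+\lambda_1^{(c)}$;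 (5) $2\lambda_1^{(a)}+\lambda_2^{(a)}\le2\lambda_2^{(b)}+\lambda_1^{(b)}+2\lambda_1^{(c)}+\lambda_2^{(c)}$; (6) $2\lambda_2^{(a)}+\lambda_3^{(a)}\le2\lambda_2^{(b)}+\lambda_1^{(b)}+2\lambda_2^{(c)}+\lambda_3^{(c)}$; (7) $2\lambda_2^{(a)}+\lambda_3^{(a)}\le2\lambda_1^{(b)}+\lambda_2^{(b)}+2\lambda_3^{(c)}+\lambda_2^{(c)}$. Points are regarded as points of the six-dimensional space with coordinates $\lambda_1^{(a)},\lambda_2^{(a)}$, $a=1,2,3$. The set $S$ is a convex polytope; its corner points are its extreme points (vertices). Notation: a point is written $[\lambda_1^{(1)}\lambda_2^{(1)}\lambda_3^{(1)},\ \lambda_1^{(2)}\lambda_2^{(2)}\lambda_3^{(2)},\ \lambda_1^{(3)}\lambda_2^{(3)}\lambda_3^{(3)}]$, so each of the three entries is a triple (juxtaposition is listing, not multiplication), with the abbreviations $O=001$, i.e. $(0,0,1)$; $A=0\tfrac12\tfrac12$, i.e. $(0,\tfrac12,\tfrac12)$; $B=\tfrac13\tfrac13\tfrac13$, i.e. $(\tfrac13,\tfrac13,\tfrac13)$. A qutrit permutation permutes the three entries of a point, i.e. permutes the upper index $a$. *)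

theory Defs
  imports "HOL-Analysis.Analysis"
begin

text \<open>
  A nine-tuple is \<open>l :: real ^ 3 ^ 3\<close>, where \<open>l $ a $ i\<close> is the entry with lower index \<open>i\<close> and
  upper index \<open>a\<close>. The index type \<open>3\<close> is arithmetic modulo 3, so its elements are exactly
  \<open>1\<close>, \<open>2\<close> and \<open>3 = 0\<close>.
\<close>

definition qutrit_set :: "(real ^ 3 ^ 3) set" where
  "qutrit_set = {l.
     (\<forall>a i. 0 \<le> l $ a $ i) \<and>
     (\<forall>a. l $ a $ 1 \<le> l $ a $ 2 \<and> l $ a $ 2 \<le> l $ a $ 3) \<and>
     (\<forall>a. l $ a $ 1 + l $ a $ 2 + l $ a $ 3 = 1) \<and>
     (\<forall>a b c. distinct [a, b, c] \<longrightarrow>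
        l$a$2 + l$a$1 \<le> l$b$2 + l$b$1 + l$c$2 + l$c$1 \<and>
        l$a$3 + l$a$1 \<le> l$b$2 + l$b$1 + l$c$3 + l$c$1 \<and>
        l$a$2 + l$a$3 \<le> l$b$2 + l$b$1 + l$c$2 + l$c$3 \<and>
        2 * l$a$2 + l$a$1 \<le> 2 * l$b$2 + l$b$1 + 2 * l$c$2 + l$c$1 \<and>
        2 * l$a$1 + l$a$2 \<le> 2 * l$b$2 + l$b$1 + 2 * l$c$1 + l$c$2 \<and>
        2 * l$a$2 + l$a$3 \<le> 2 * l$b$2 + l$b$1 + 2 * l$c$2 + l$c$3 \<and>
        2 * l$a$2 + l$a$3 \<le> 2 * l$b$1 + l$b$2 + 2 * l$c$3 + l$c$2)}"

text \<open>
  The coordinates \<open>l $ a $ 1\<close> and \<open>l $ a $ 2\<close> in six-dimensional space. This map is injective on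
  \<open>qutrit_set\<close>, since there each row sums to 1.
\<close>

definition coords :: "real ^ 3 ^ 3 \<Rightarrow> real ^ 2 ^ 3" where
  "coords l = (\<chi> a. vector [l $ a $ 1, l $ a $ 2])"

definition permute_qutrits :: "(3 \<Rightarrow> 3) \<Rightarrow> real ^ 3 ^ 3 \<Rightarrow> real ^ 3 ^ 3" where
  "permute_qutrits \<sigma> l = (\<chi> a. l $ \<sigma> a)"

definition triple_O :: "real ^ 3" where "triple_O = vector [0, 0, 1]"
definition triple_A :: "real ^ 3" where "triple_A = vector [0, 1/2, 1/2]"
definition triple_B :: "real ^ 3" where "triple_B = vector [1/3, 1/3, 1/3]"

definition listed_points :: "(real ^ 3 ^ 3) set" where
  "listed_points =
    {vector [triple_O, triple_O, triple_O],
     vector [triple_O, triple_A, triple_A],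
     vector [triple_O, triple_B, triple_B],
     vector [triple_A, triple_A, triple_A],
     vector [triple_A, triple_A, triple_B],
     vector [triple_A, triple_B, triple_B],
     vector [triple_B, triple_B, triple_B],
     vector [triple_B, vector [0, 1/3, 2/3], vector [0, 1/3, 2/3]],
     vector [triple_A, vector [0, 1/4, 3/4], vector [1/4, 1/4, 1/2]],
     vector [triple_A, triple_B, vector [1/6, 1/6, 2/3]],
     vector [triple_A, vector [1/6, 1/6, 2/3], vector [1/6, 1/6, 2/3]]}"

end

theory Submission
  imports Defs
begin

text \<open>
  Rows with \<open>0 \<le> t$1 \<le> t$2 \<le> t$3\<close> and sum 1 form the triangle with corners \<open>O\<close>, \<open>A\<close>, \<open>B\<close>, so the
  polytope is a product of three triangles truncated by the inequalities (1) to (7). An extreme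
  point at which none of these is tight is an extreme point of the product, hence has all rows in
  \<open>{O, A, B}\<close>. If one of them is tight, the point lies in the corresponding face, which happens to
  be a simplex with six listed vertices, and it is therefore one of them. Conversely, listed points
  with rows in \<open>{O, A, B}\<close> are already extreme in the product, and each of the remaining four is
  exposed by an explicit supporting hyperplane.
\<close>

subsection \<open>Extreme points\<close>

text \<open>Injectivity on \<open>S\<close> suffices: convexity keeps every point of a segment
  between points of \<open>S\<close> inside \<open>S\<close>, so an equation between images can be
  pulled back.\<close>

lemma extreme_point_of_image_inj_on:
  fixes f :: "'a::real_vector \<Rightarrow> 'b::real_vector"
  assumes f: "linear f" and S: "convex S" and inj: "inj_on f S" and x: "x \<in> S"
  shows "f x extreme_point_of (f ` S) \<longleftrightarrow> x extreme_point_of S"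
proof -
  have "f x \<in> open_segment (f a) (f b) \<longleftrightarrow> x \<in> open_segment a b" if "a \<in> S" "b \<in> S" for a b
  proof -
    have "f x = (1 - u) *\<^sub>R f a + u *\<^sub>R f b \<longleftrightarrow> x = (1 - u) *\<^sub>R a + u *\<^sub>R b"
      if "0 < u" "u < 1" for u
    proof -
      have "(1 - u) *\<^sub>R a + u *\<^sub>R b \<in> S"
        using S \<open>a \<in> S\<close> \<open>b \<in> S\<close> that by (simp add: convex_alt)
      moreover have "(1 - u) *\<^sub>R f a + u *\<^sub>R f b = f ((1 - u) *\<^sub>R a + u *\<^sub>R b)"
        by (simp add: f linear_add linear_scale)
      ultimately show ?thesis
        using inj x by (auto simp: inj_on_eq_iff)
    qed
    moreover have "f a = f b \<longleftrightarrow> a = b"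
      using inj that by (auto simp: inj_on_eq_iff)
    ultimately show ?thesis
      by (auto simp: in_segment)
  qed
  then show ?thesis
    using x by (auto simp: extreme_point_of_def)
qed

lemma extreme_points_of_image_inj_on:
  fixes f :: "'a::real_vector \<Rightarrow> 'b::real_vector"
  assumes "linear f" "convex S" "inj_on f S"
  shows "{v. v extreme_point_of (f ` S)} = f ` {x. x extreme_point_of S}"
  using extreme_point_of_image_inj_on[OF assms] by (auto simp: extreme_point_of_def)

lemma extreme_point_of_subset:
  assumes "x extreme_point_of S" "x \<in> T" "T \<subseteq> S"
  shows "x extreme_point_of T"
  using assms by (auto simp: extreme_point_of_def)

text \<open>A segment of \<open>K\<close> through \<open>x\<close> can be shrunk towards \<open>x\<close> until it lies in \<open>U\<close>.\<close>

lemma extreme_point_of_Int_open: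
  fixes K U :: "'a::real_normed_vector set"
  assumes x: "x extreme_point_of (K \<inter> U)" and K: "convex K" and U: "open U"
  shows "x extreme_point_of K"
  unfolding extreme_point_of_def
proof (intro conjI ballI notI)
  show xK: "x \<in> K" using x by (simp add: extreme_point_of_def)
  fix a b assume ab: "a \<in> K" "b \<in> K" "x \<in> open_segment a b"
  \<comment> \<open>The homothety with centre \<open>x\<close> and ratio \<open>e\<close>: a small
    \<open>e\<close> brings both endpoints into \<open>U\<close>, while \<open>x\<close> keeps its
    relative position \<open>u\<close> on the segment.\<close>
  define g where "g c e = x + e *\<^sub>R (c - x)" for c e
  have near: "\<forall>\<^sub>F e in at_right 0. g c e \<in> U" for c
  proof -
    have "((\<lambda>e. g c e) \<longlongrightarrow> x + 0 *\<^sub>R (c - x)) (at_right 0)"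
      unfolding g_def by (intro tendsto_intros)
    moreover have "x \<in> U" using x by (simp add: extreme_point_of_def)
    ultimately show ?thesis using U by (simp add: topological_tendstoD)
  qed
  have "\<forall>\<^sub>F e in at_right (0::real). 0 < e \<and> e < 1"
    by (auto simp: eventually_at_right[of 0 1] intro!: exI[of _ 1])
  with near[of a] near[of b]
  have "\<forall>\<^sub>F e in at_right 0. g a e \<in> U \<and> g b e \<in> U \<and> 0 < e \<and> e < 1"
    by (simp add: eventually_conj_iff)
  then obtain e where e: "g a e \<in> U" "g b e \<in> U" "0 < e" "e < 1"
    using eventually_happens'[OF trivial_limit_at_right_real] by blast
  have gK: "g c e \<in> K" if "c \<in> K" for c
  proof -
    have "g c e = (1 - e) *\<^sub>R x + e *\<^sub>R c" by (simp add: g_def algebra_simps)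
    then show ?thesis using K xK that e by (simp add: convex_alt)
  qed
  obtain u where u: "a \<noteq> b" "0 < u" "u < 1" "x = (1 - u) *\<^sub>R a + u *\<^sub>R b"
    using ab(3) by (auto simp: in_segment)
  have "(1 - u) *\<^sub>R g a e + u *\<^sub>R g b e = x + e *\<^sub>R ((1 - u) *\<^sub>R a + u *\<^sub>R b - x)"
    by (simp add: g_def algebra_simps)
  also have "\<dots> = x" using u(4) by simp
  finally have "x = (1 - u) *\<^sub>R g a e + u *\<^sub>R g b e" by simp
  moreover have "g a e \<noteq> g b e" using u(1) e(3) by (simp add: g_def)
  ultimately have "x \<in> open_segment (g a e) (g b e)"
    using u by (auto simp: in_segment)
  then show False
    using x gK ab e by (auto simp: extreme_point_of_def)
qed

text \<open>A segment through \<open>x $ i\<close> lifts to the product by freezing the other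
  coordinates. Conversely, the ends of a nondegenerate segment differ in some coordinate, and the
  projection to it is a nondegenerate segment with the same ratio.\<close>

lemma extreme_point_of_product:
  fixes x :: "'a::real_vector ^ 'n"
  assumes K: "\<And>i. x $ i \<in> K i"
  shows "x extreme_point_of {y. \<forall>i. y $ i \<in> K i} \<longleftrightarrow> (\<forall>i. x $ i extreme_point_of K i)"
proof (intro iffI allI)
  fix i assume x: "x extreme_point_of {y. \<forall>i. y $ i \<in> K i}"
  show "x $ i extreme_point_of K i"
    unfolding extreme_point_of_def
  proof (intro conjI ballI notI K)
    fix a b assume ab: "a \<in> K i" "b \<in> K i" "x $ i \<in> open_segment a b"
    define g where "g c = (\<chi> j. if j = i then c else x $ j)" for c
    obtain u where u: "a \<noteq> b" "0 < u" "u < 1" "x $ i = (1 - u) *\<^sub>R a + u *\<^sub>R b"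
      using ab(3) by (auto simp: in_segment)
    have "g a \<noteq> g b" using u(1) by (auto simp: g_def vec_eq_iff)
    moreover have "x = (1 - u) *\<^sub>R g a + u *\<^sub>R g b"
      using u(4) by (simp add: g_def vec_eq_iff flip: scaleR_left_distrib)
    ultimately have "x \<in> open_segment (g a) (g b)"
      using u by (auto simp: in_segment)
    moreover have "g a \<in> {y. \<forall>i. y $ i \<in> K i}" "g b \<in> {y. \<forall>i. y $ i \<in> K i}"
      using ab K by (auto simp: g_def)
    ultimately show False using x by (auto simp: extreme_point_of_def)
  qed
next
  assume x: "\<forall>i. x $ i extreme_point_of K i"
  show "x extreme_point_of {y. \<forall>i. y $ i \<in> K i}"
    unfolding extreme_point_of_def
  proof (intro conjI ballI notI)
    show "x \<in> {y. \<forall>i. y $ i \<in> K i}" using K by simp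
    fix a b assume ab: "a \<in> {y. \<forall>i. y $ i \<in> K i}" "b \<in> {y. \<forall>i. y $ i \<in> K i}"
      "x \<in> open_segment a b"
    obtain u where u: "a \<noteq> b" "0 < u" "u < 1" "x = (1 - u) *\<^sub>R a + u *\<^sub>R b"
      using ab(3) by (auto simp: in_segment)
    then obtain i where "a $ i \<noteq> b $ i" by (auto simp: vec_eq_iff)
    moreover have "x $ i = (1 - u) *\<^sub>R (a $ i) + u *\<^sub>R (b $ i)" using u(4) by simp
    ultimately have "x $ i \<in> open_segment (a $ i) (b $ i)"
      using u by (auto simp: in_segment)
    then show False using x ab by (auto simp: extreme_point_of_def)
  qed
qed

text \<open>Removing an extreme point from a convex set leaves a convex set, so points
  \<open>v i\<close> all different from \<open>x\<close> could only average to a point of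
  \<open>S - {x}\<close>.\<close>

lemma extreme_point_of_convex_combination:
  assumes x: "x extreme_point_of S" and S: "convex S"
    and I: "finite I" "\<And>i. i \<in> I \<Longrightarrow> 0 \<le> t i" "sum t I = 1" "\<And>i. i \<in> I \<Longrightarrow> v i \<in> S"
    and eq: "x = (\<Sum>i\<in>I. t i *\<^sub>R v i)"
  shows "x \<in> v ` I"
proof (rule ccontr)
  assume "x \<notin> v ` I"
  then have "v i \<in> S - {x}" if "i \<in> I" for i using I(4) that by auto
  moreover have "convex (S - {x})"
    using x S by (simp add: extreme_point_of_stillconvex)
  ultimately have "(\<Sum>i\<in>I. t i *\<^sub>R v i) \<in> S - {x}"
    using I by (intro convex_sum) auto
  then show False using eq by simp
qed

subsection \<open>The polytope as a truncated product of triangles\<close>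

definition row_triangle :: "(real ^ 3) set" where
  "row_triangle = {t. (\<forall>i. 0 \<le> t $ i) \<and> t$1 \<le> t$2 \<and> t$2 \<le> t$3 \<and> t$1 + t$2 + t$3 = 1}"

text \<open>A rule \<open>(p, q, r)\<close> encodes the family \<open>p \<bullet> l $ a \<le> q \<bullet> l $ b + r \<bullet> l $ c\<close>; the seven rules
  are the inequalities (1) to (7).\<close>

definition rules :: "((real^3) \<times> (real^3) \<times> (real^3)) list" where
  "rules = [
     (vector [1,1,0], vector [1,1,0], vector [1,1,0]),
     (vector [1,0,1], vector [1,1,0], vector [1,0,1]),
     (vector [0,1,1], vector [1,1,0], vector [0,1,1]),
     (vector [1,2,0], vector [1,2,0], vector [1,2,0]),
     (vector [2,1,0], vector [1,2,0], vector [2,1,0]),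
     (vector [0,2,1], vector [1,2,0], vector [0,2,1]),
     (vector [0,2,1], vector [2,1,0], vector [0,1,2])]"

text \<open>Right-hand side minus left-hand side, so tightness is a zero; linearity in
  \<open>l\<close> yields convexity and continuity.\<close>

definition slack ::
    "(real^3) \<times> (real^3) \<times> (real^3) \<Rightarrow> 'n \<Rightarrow> 'n \<Rightarrow> 'n \<Rightarrow> real^3^'n \<Rightarrow> real" where
  "slack w a b c l =
     fst (snd w) \<bullet> l $ b + snd (snd w) \<bullet> l $ c - fst w \<bullet> l $ a"

lemma inner_3: "x \<bullet> y = x$1 * y$1 + x$2 * y$2 + x$3 * y$3" for x y :: "real^3"
  by (simp add: inner_vec_def sum_3)

lemma all_distinct_3:
  "(\<forall>a b c::3. distinct [a, b, c] \<longrightarrow> P a b c) \<longleftrightarrow>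
     P 1 2 3 \<and> P 1 3 2 \<and> P 2 1 3 \<and> P 2 3 1 \<and> P 3 1 2 \<and> P 3 2 1"
  by (simp add: forall_3)

lemma qutrit_set_iff:
  "l \<in> qutrit_set \<longleftrightarrow>
     (\<forall>a. l $ a \<in> row_triangle) \<and>
     (\<forall>w\<in>set rules. \<forall>a b c. distinct [a, b, c] \<longrightarrow> 0 \<le> slack w a b c l)"
  unfolding qutrit_set_def rules_def slack_def row_triangle_def
  by (simp add: inner_3 del: distinct.simps) (auto simp: algebra_simps)

lemma qutrit_set_row_triangle: "l \<in> qutrit_set \<Longrightarrow> l $ a \<in> row_triangle"
  by (simp add: qutrit_set_iff)

lemma slack_nonneg:
  "l \<in> qutrit_set \<Longrightarrow> w \<in> set rules \<Longrightarrow> distinct [a, b, c] \<Longrightarrow> 0 \<le> slack w a b c l"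
  by (simp add: qutrit_set_iff)

lemma linear_slack: "linear (slack w a b c)"
  by (rule linearI) (simp_all add: slack_def inner_simps algebra_simps)

lemma continuous_on_slack: "continuous_on A (slack w a b c)"
  by (simp add: linear_continuous_on linear_linear linear_slack)

section \<open>The triangle of rows\<close>

lemmas triple_defs = triple_O_def triple_A_def triple_B_def

lemma row_triangle_eq_convex_hull: "row_triangle = convex hull {triple_O, triple_A, triple_B}"
proof (intro set_eqI iffI)
  fix t assume t: "t \<in> row_triangle"
  \<comment> \<open>Barycentric coordinates: the successive gaps between the entries, scaled by 1, 2
    and 3 because \<open>O\<close>, \<open>A\<close> and \<open>B\<close> spread their mass evenly
    over one, two and three entries.\<close>
  have "t = (t$3 - t$2) *\<^sub>R triple_O + (2 * (t$2 - t$1)) *\<^sub>R triple_A + (3 * t$1) *\<^sub>R triple_B"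
    using t by (auto simp: vec_eq_iff forall_3 triple_defs row_triangle_def field_simps)
  moreover have "0 \<le> t$3 - t$2" "0 \<le> 2 * (t$2 - t$1)" "0 \<le> 3 * t$1"
    "t$3 - t$2 + 2 * (t$2 - t$1) + 3 * t$1 = 1"
    using t by (auto simp: row_triangle_def)
  ultimately show "t \<in> convex hull {triple_O, triple_A, triple_B}"
    unfolding convex_hull_3 by blast
qed (auto simp: convex_hull_3 row_triangle_def triple_defs forall_3)

lemma convex_row_triangle: "convex row_triangle"
  by (simp add: row_triangle_eq_convex_hull)

lemma extreme_point_of_row_triangle:
  "t extreme_point_of row_triangle \<longleftrightarrow> t \<in> {triple_O, triple_A, triple_B}"
proof
  show "t \<in> {triple_O, triple_A, triple_B}" if "t extreme_point_of row_triangle"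
    using that unfolding row_triangle_eq_convex_hull by (rule extreme_point_of_convex_hull)
  \<comment> \<open>The functionals \<open>t$1 + t$2\<close>, \<open>t$1 - t$2 + t$3\<close> and
    \<open>t$3 - t$1\<close> are nonnegative on the triangle and vanish only at \<open>O\<close>,
    \<open>A\<close> and \<open>B\<close> respectively.\<close>
  have "triple_O extreme_point_of row_triangle"
    by (rule extreme_point_of_Int_supporting_hyperplane_ge[of _ "vector [1, 1, 0]" 0])
       (auto simp: row_triangle_def triple_defs forall_3 inner_3 vec_eq_iff)
  moreover have "triple_A extreme_point_of row_triangle"
    by (rule extreme_point_of_Int_supporting_hyperplane_ge[of _ "vector [1, -1, 1]" 0])
       (auto simp: row_triangle_def triple_defs forall_3 inner_3 vec_eq_iff)
  moreover have "triple_B extreme_point_of row_triangle"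
    by (rule extreme_point_of_Int_supporting_hyperplane_ge[of _ "vector [-1, 0, 1]" 0])
       (auto simp: row_triangle_def triple_defs forall_3 inner_3 vec_eq_iff)
  ultimately show "t extreme_point_of row_triangle" if "t \<in> {triple_O, triple_A, triple_B}"
    using that by auto
qed

lemma convex_triangle_product: "convex {l :: real^3^'n. \<forall>a. l $ a \<in> row_triangle}"
  by (rule convexI) (use convex_row_triangle in \<open>auto simp: convexD\<close>)

lemma convex_qutrit_set: "convex qutrit_set"
proof (rule convexI)
  fix x y :: "real^3^3" and u v :: real
  assume xy: "x \<in> qutrit_set" "y \<in> qutrit_set" and uv: "0 \<le> u" "0 \<le> v" "u + v = 1"
  have "(u *\<^sub>R x + v *\<^sub>R y) $ a \<in> row_triangle" for a
    using convexD[OF convex_row_triangle, of "x $ a" "y $ a" u v] xy uv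
    by (simp add: qutrit_set_row_triangle)
  moreover have "0 \<le> slack w a b c (u *\<^sub>R x + v *\<^sub>R y)"
    if "w \<in> set rules" "distinct [a, b, c]" for w a b c
    using xy uv that slack_nonneg by (simp add: linear_add linear_scale linear_slack)
  ultimately show "u *\<^sub>R x + v *\<^sub>R y \<in> qutrit_set"
    by (simp add: qutrit_set_iff)
qed

lemma extreme_point_of_qutrit_setD: "p extreme_point_of qutrit_set \<Longrightarrow> p \<in> qutrit_set"
  by (simp add: extreme_point_of_def)

lemma extreme_without_tight_rule:
  assumes p: "p extreme_point_of qutrit_set"
    and pos: "\<And>w a b c. w \<in> set rules \<Longrightarrow> distinct [a, b, c] \<Longrightarrow> slack w a b c p \<noteq> 0"
  shows "p $ a \<in> {triple_O, triple_A, triple_B}"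
proof -
  let ?K = "{l :: real^3^3. \<forall>a. l $ a \<in> row_triangle}"
  \<comment> \<open>All inequalities made strict: a finite intersection of open half-spaces, on
    which the polytope and the product of triangles coincide.\<close>
  define U where "U = (\<Inter>w\<in>set rules. \<Inter>(a, b, c)\<in>{(a, b, c). distinct [a, b, c]}.
    {l :: real^3^3. 0 < slack w a b c l})"
  have pS: "p \<in> qutrit_set" using p by (rule extreme_point_of_qutrit_setD)
  have "open {l :: real^3^3. 0 < slack w a b c l}" for w a b c
    by (intro open_Collect_less continuous_on_const continuous_on_slack)
  then have "open U"
    unfolding U_def by (intro open_INT) auto
  moreover have "p \<in> ?K \<inter> U"
    using pS pos by (fastforce simp: qutrit_set_iff U_def less_le)
  moreover have "?K \<inter> U \<subseteq> qutrit_set"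
    by (fastforce simp: qutrit_set_iff U_def less_le)
  ultimately have "p extreme_point_of ?K"
    using p extreme_point_of_Int_open[OF _ convex_triangle_product, of p U]
      extreme_point_of_subset[of p qutrit_set "?K \<inter> U"] by simp
  then have "p $ a extreme_point_of row_triangle"
    using extreme_point_of_product[of p "\<lambda>_. row_triangle"] pS by (simp add: qutrit_set_row_triangle)
  then show ?thesis by (simp add: extreme_point_of_row_triangle)
qed

text \<open>The product of triangles contains the polytope, and extremality passes to any subset
  that contains the point.\<close>

lemma extreme_if_rows_extreme:
  assumes "p \<in> qutrit_set" "\<And>a. p $ a \<in> {triple_O, triple_A, triple_B}"
  shows "p extreme_point_of qutrit_set"
proof (rule extreme_point_of_subset)
  show "p extreme_point_of {l. \<forall>a. l $ a \<in> row_triangle}"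
    using extreme_point_of_product[of p "\<lambda>_. row_triangle"] assms
    by (simp add: qutrit_set_row_triangle extreme_point_of_row_triangle)
qed (use assms in \<open>auto simp: qutrit_set_row_triangle\<close>)

subsection \<open>Qutrit permutations\<close>

text \<open>The right-hand side of the theorem before projection, so that the argument can stay with
  nine-tuples.\<close>

definition corners :: "(real ^ 3 ^ 3) set" where
  "corners = {permute_qutrits \<sigma> x | \<sigma> x. \<sigma> permutes UNIV \<and> x \<in> listed_points}"

lemma permute_qutrits_nth [simp]: "permute_qutrits \<sigma> l $ a = l $ \<sigma> a"
  by (simp add: permute_qutrits_def)

text \<open>The action is precomposition on the upper index, which reverses the order of
  composition.\<close>

lemma permute_qutrits_comp:
  "permute_qutrits \<sigma> (permute_qutrits \<tau> l) = permute_qutrits (\<tau> \<circ> \<sigma>) l"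
  by (simp add: vec_eq_iff)

lemma linear_permute_qutrits: "linear (permute_qutrits \<sigma>)"
  by (rule linearI) (simp_all add: vec_eq_iff)

lemma permute_qutrits_inv:
  assumes "\<sigma> permutes UNIV"
  shows "permute_qutrits (inv \<sigma>) (permute_qutrits \<sigma> l) = l"
    "permute_qutrits \<sigma> (permute_qutrits (inv \<sigma>) l) = l"
  using permutes_inverses[OF assms] by (simp_all add: vec_eq_iff)

lemma slack_permute_qutrits:
  "slack w a b c (permute_qutrits \<sigma> l) = slack w (\<sigma> a) (\<sigma> b) (\<sigma> c) l"
  by (simp add: slack_def)

lemma permute_qutrits_in_qutrit_set:
  assumes "\<sigma> permutes UNIV" "l \<in> qutrit_set"
  shows "permute_qutrits \<sigma> l \<in> qutrit_set"
  using assms permutes_inj[OF assms(1)] unfolding qutrit_set_iff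
  by (simp add: slack_permute_qutrits inj_eq)

lemma permute_qutrits_image_qutrit_set:
  assumes "\<sigma> permutes UNIV"
  shows "permute_qutrits \<sigma> ` qutrit_set = qutrit_set"
  by (metis (no_types) assms image_subset_iff permute_qutrits_in_qutrit_set permute_qutrits_inv(2)
      permutes_inv subset_antisym subsetI image_eqI)

text \<open>A row permutation maps the polytope linearly and bijectively onto itself, since the
  inequalities range over all orders of the indices.\<close>

lemma extreme_permute_qutrits:
  assumes \<sigma>: "\<sigma> permutes UNIV" and p: "p extreme_point_of qutrit_set"
  shows "permute_qutrits \<sigma> p extreme_point_of qutrit_set"
proof -
  have "inj_on (permute_qutrits \<sigma>) qutrit_set"
    by (metis \<sigma> inj_on_inverseI permute_qutrits_inv(1))
  then show ?thesis
    using extreme_point_of_image_inj_on[OF linear_permute_qutrits convex_qutrit_set _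
        extreme_point_of_qutrit_setD[OF p], of \<sigma>] p permute_qutrits_image_qutrit_set[OF \<sigma>]
    by simp
qed

lemma permute_qutrits_in_corners:
  assumes \<sigma>: "\<sigma> permutes UNIV" and "p \<in> corners"
  shows "permute_qutrits \<sigma> p \<in> corners"
  using assms permutes_compose[OF \<sigma>] unfolding corners_def
  by (fastforce simp: permute_qutrits_comp)

lemma ex_permutation_3:
  assumes "distinct [a, b, c :: 3]"
  obtains \<sigma> where "\<sigma> permutes UNIV" "\<sigma> 1 = a" "\<sigma> 2 = b" "\<sigma> 3 = c"
proof
  let ?\<sigma> = "\<lambda>i::3. if i = 1 then a else if i = 2 then b else c"
  have "inj ?\<sigma>" using assms by (auto intro!: injI split: if_splits) (metis exhaust_3)+
  then show "?\<sigma> permutes UNIV"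
    \<comment> \<open>An injective self-map of a finite type is surjective.\<close>
    by (intro bij_imp_permutes bijI finite_UNIV_inj_surj) (assumption | rule finite UNIV_I | simp)+
qed auto

text \<open>Spells out the orbit of a listed point as explicit vectors, so that membership in
  \<open>corners\<close> reduces to matching terms.\<close>

lemma vector_in_corners:
  assumes "vector [u, v, w] \<in> listed_points"
  shows "vector [u, v, w] \<in> corners" "vector [u, w, v] \<in> corners" "vector [v, u, w] \<in> corners"
    "vector [v, w, u] \<in> corners" "vector [w, u, v] \<in> corners" "vector [w, v, u] \<in> corners"
proof -
  have *: "vector [l $ a, l $ b, l $ c] \<in> corners"
    if "distinct [a, b, c]" "l \<in> listed_points" for l and a b c :: 3
  proof -
    obtain \<sigma> where \<sigma>: "\<sigma> permutes UNIV" "\<sigma> 1 = a" "\<sigma> 2 = b" "\<sigma> 3 = c"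
      using ex_permutation_3[OF \<open>distinct [a, b, c]\<close>] .
    then have "vector [l $ a, l $ b, l $ c] = permute_qutrits \<sigma> l"
      by (simp add: vec_eq_iff forall_3)
    then show ?thesis using \<sigma>(1) \<open>l \<in> listed_points\<close> by (auto simp: corners_def)
  qed
  show "vector [u, v, w] \<in> corners" "vector [u, w, v] \<in> corners" "vector [v, u, w] \<in> corners"
    "vector [v, w, u] \<in> corners" "vector [w, u, v] \<in> corners" "vector [w, v, u] \<in> corners"
    using *[OF _ assms, of 1 2 3] *[OF _ assms, of 1 3 2] *[OF _ assms, of 2 1 3]
      *[OF _ assms, of 2 3 1] *[OF _ assms, of 3 1 2] *[OF _ assms, of 3 2 1] by simp_all
qed

lemma listed_point_intros:
  "vector [triple_O, triple_O, triple_O] \<in> listed_points"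
  "vector [triple_O, triple_A, triple_A] \<in> listed_points"
  "vector [triple_O, triple_B, triple_B] \<in> listed_points"
  "vector [triple_A, triple_A, triple_A] \<in> listed_points"
  "vector [triple_A, triple_A, triple_B] \<in> listed_points"
  "vector [triple_A, triple_B, triple_B] \<in> listed_points"
  "vector [triple_B, triple_B, triple_B] \<in> listed_points"
  "vector [triple_B, vector [0, 1/3, 2/3], vector [0, 1/3, 2/3]] \<in> listed_points"
  "vector [triple_A, vector [0, 1/4, 3/4], vector [1/4, 1/4, 1/2]] \<in> listed_points"
  "vector [triple_A, triple_B, vector [1/6, 1/6, 2/3]] \<in> listed_points"
  "vector [triple_A, vector [1/6, 1/6, 2/3], vector [1/6, 1/6, 2/3]] \<in> listed_points"
  unfolding listed_points_def by (rule insertI1 insertI2)+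

lemmas corner_intros = listed_point_intros[THEN vector_in_corners(1)]
  listed_point_intros[THEN vector_in_corners(2)] listed_point_intros[THEN vector_in_corners(3)]
  listed_point_intros[THEN vector_in_corners(4)] listed_point_intros[THEN vector_in_corners(5)]
  listed_point_intros[THEN vector_in_corners(6)]

section \<open>Entrywise form of the constraints\<close>

lemma length_rules: "length rules = 7"
  by (simp add: rules_def)

lemma rule_slack_nonneg:
  "l \<in> qutrit_set \<Longrightarrow> i < 7 \<Longrightarrow> distinct [a, b, c] \<Longrightarrow> 0 \<le> slack (rules ! i) a b c l"
  by (rule slack_nonneg[OF _ nth_mem]) (simp_all add: length_rules)

lemma qutrit_set_row:
  assumes "l \<in> qutrit_set"
  shows "0 \<le> l $ a $ i" "l $ a $ 1 \<le> l $ a $ 2" "l $ a $ 2 \<le> l $ a $ 3"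
  using qutrit_set_row_triangle[OF assms, of a] by (simp_all add: row_triangle_def)

lemma qutrit_set_row_sum:
  assumes "l \<in> qutrit_set"
  shows "l $ 1 $ 1 + l $ 1 $ 2 + l $ 1 $ 3 = 1" "l $ 2 $ 1 + l $ 2 $ 2 + l $ 2 $ 3 = 1"
    "l $ 3 $ 1 + l $ 3 $ 2 + l $ 3 $ 3 = 1"
  using qutrit_set_row_triangle[OF assms] by (simp_all add: row_triangle_def)

subsection \<open>The listed points are extreme\<close>

lemma listed_points_in_qutrit_set: "x \<in> listed_points \<Longrightarrow> x \<in> qutrit_set"
  unfolding listed_points_def insert_iff empty_iff qutrit_set_iff all_distinct_3
  by (elim disjE; simp add: row_triangle_def forall_3 rules_def slack_def inner_3 triple_defs)

lemma extreme_of_hyperplane: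
  assumes "p \<in> S" "a \<bullet> p = b" "\<And>l. l \<in> S \<Longrightarrow> b \<le> a \<bullet> l" "\<And>l. l \<in> S \<Longrightarrow> a \<bullet> l = b \<Longrightarrow> l = p"
  shows "p extreme_point_of S"
  by (rule extreme_point_of_Int_supporting_hyperplane_ge[of _ a b]) (use assms in blast)+

text \<open>For each of the four points with a row outside \<open>{O, A, B}\<close>, the normal vector is the sum of the
  normals of inequalities that are tight there.\<close>

lemma extreme_special_points:
  "vector [triple_B, vector [0, 1/3, 2/3], vector [0, 1/3, 2/3]] extreme_point_of qutrit_set"
    (is "?P1 extreme_point_of _")
  "vector [triple_A, vector [0, 1/4, 3/4], vector [1/4, 1/4, 1/2]] extreme_point_of qutrit_set"
    (is "?P2 extreme_point_of _")
  "vector [triple_A, triple_B, vector [1/6, 1/6, 2/3]] extreme_point_of qutrit_set"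
    (is "?P3 extreme_point_of _")
  "vector [triple_A, vector [1/6, 1/6, 2/3], vector [1/6, 1/6, 2/3]] extreme_point_of qutrit_set"
    (is "?P4 extreme_point_of _")
proof -
  have "0 \<le> slack (rules ! 1) 2 3 1 l" "0 \<le> slack (rules ! 1) 3 2 1 l"
    "0 \<le> slack (rules ! 2) 1 2 3 l" "0 \<le> slack (rules ! 2) 1 3 2 l"
    "0 \<le> slack (rules ! 2) 2 3 1 l" "0 \<le> slack (rules ! 2) 3 2 1 l"
    if "l \<in> qutrit_set" for l
    using that by (simp_all add: rule_slack_nonneg)
  \<comment> \<open>Facts 1 and 2 are instances of inequality (2), facts 3 to 6 of inequality (3); 7
    to 9 are nonnegativity of the first entry and the ordering of a row, and 10 to 12 are the row
    sums.\<close>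
  note ineqs = this[unfolded slack_def rules_def inner_3, simplified]
    qutrit_set_row(1)[of _ _ 1] qutrit_set_row(2,3) qutrit_set_row_sum
  note expand = inner_vec_def[where 'b = 3 and 'a = "real^3"] inner_3 sum_3
  note coords = vec_eq_iff forall_3 triple_defs vector_3
  show "?P1 extreme_point_of qutrit_set"
  proof (rule extreme_of_hyperplane[where b = 0
        and a = "vector [vector [-1, 2, 3], vector [2, 0, -1], vector [2, 0, -1]]"])
    fix l assume l: "l \<in> qutrit_set"
    \<comment> \<open>Besides the row sums these are six homogeneous inequalities tight at the
      point, and the functional is the sum of their slacks. If it vanishes, so does each slack, and
      with the row sums only one point remains. The other three cases follow the same
      pattern.\<close>
    note ineqs = ineqs(5,6,10-12)[OF l] ineqs(8,9)[OF l, of 1] ineqs(7)[OF l, of 2]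
      ineqs(7)[OF l, of 3]
    show "0 \<le> vector [vector [-1, 2, 3], vector [2, 0, -1], vector [2, 0, -1]] \<bullet> l"
      using ineqs unfolding expand vector_3 by linarith
    assume "vector [vector [-1, 2, 3], vector [2, 0, -1], vector [2, 0, -1]] \<bullet> l = 0"
    then show "l = ?P1"
      using ineqs unfolding expand coords by (intro conjI; linarith)
  qed (rule listed_points_in_qutrit_set, rule listed_point_intros, simp add: expand triple_defs)
  show "?P2 extreme_point_of qutrit_set"
  proof (rule extreme_of_hyperplane[where b = 0
        and a = "vector [vector [2, -2, 1], vector [3, 2, 0], vector [-2, 2, 0]]"])
    fix l assume l: "l \<in> qutrit_set"
    note ineqs = ineqs(2,3,10-12)[OF l] ineqs(7,9)[OF l, of 1] ineqs(7)[OF l, of 2]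
      ineqs(8)[OF l, of 3]
    show "0 \<le> vector [vector [2, -2, 1], vector [3, 2, 0], vector [-2, 2, 0]] \<bullet> l"
      using ineqs unfolding expand vector_3 by linarith
    assume "vector [vector [2, -2, 1], vector [3, 2, 0], vector [-2, 2, 0]] \<bullet> l = 0"
    then show "l = ?P2"
      using ineqs unfolding expand coords by (intro conjI; linarith)
  qed (rule listed_points_in_qutrit_set, rule listed_point_intros, simp add: expand triple_defs)
  show "?P3 extreme_point_of qutrit_set"
  proof (rule extreme_of_hyperplane[where b = 0
        and a = "vector [vector [1, -2, 0], vector [-1, 1, 2], vector [0, 2, 0]]"])
    fix l assume l: "l \<in> qutrit_set"
    note ineqs = ineqs(4,10-12)[OF l] ineqs(7,9)[OF l, of 1] ineqs(8,9)[OF l, of 2]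
      ineqs(8)[OF l, of 3]
    show "0 \<le> vector [vector [1, -2, 0], vector [-1, 1, 2], vector [0, 2, 0]] \<bullet> l"
      using ineqs unfolding expand vector_3 by linarith
    assume "vector [vector [1, -2, 0], vector [-1, 1, 2], vector [0, 2, 0]] \<bullet> l = 0"
    then show "l = ?P3"
      using ineqs unfolding expand coords by (intro conjI; linarith)
  qed (rule listed_points_in_qutrit_set, rule listed_point_intros, simp add: expand triple_defs)
  show "?P4 extreme_point_of qutrit_set"
  proof (rule extreme_of_hyperplane[where b = 0
        and a = "vector [vector [3, -1, 3], vector [-1, 2, -1], vector [-1, 2, -1]]"])
    fix l assume l: "l \<in> qutrit_set"
    note ineqs = ineqs(1,2,10-12)[OF l] ineqs(7,9)[OF l, of 1] ineqs(8)[OF l, of 2]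
      ineqs(8)[OF l, of 3]
    show "0 \<le> vector [vector [3, -1, 3], vector [-1, 2, -1], vector [-1, 2, -1]] \<bullet> l"
      using ineqs unfolding expand vector_3 by linarith
    assume "vector [vector [3, -1, 3], vector [-1, 2, -1], vector [-1, 2, -1]] \<bullet> l = 0"
    then show "l = ?P4"
      using ineqs unfolding expand coords by (intro conjI; linarith)
  qed (rule listed_points_in_qutrit_set, rule listed_point_intros, simp add: expand triple_defs)
qed

lemma listed_point_extreme:
  assumes "x \<in> listed_points"
  shows "x extreme_point_of qutrit_set"
proof (cases "\<forall>a. x $ a \<in> {triple_O, triple_A, triple_B}")
  case True
  then show ?thesis
    using assms by (simp add: extreme_if_rows_extreme listed_points_in_qutrit_set)
next
  case False
  then show ?thesis
    using assms extreme_special_points unfolding listed_points_def by (auto simp: forall_3)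
qed

lemma corner_extreme: "x \<in> corners \<Longrightarrow> x extreme_point_of qutrit_set"
  by (auto simp: corners_def extreme_permute_qutrits listed_point_extreme)

subsection \<open>Every extreme point is listed\<close>

text \<open>Corners lie in the polytope, so an extreme point averaged from them equals one of them.
  The list of weighted corners is the certificate supplied for each facet.\<close>

lemma extreme_of_corner_combination:
  assumes p: "p extreme_point_of qutrit_set"
    and cs: "\<forall>(t, v)\<in>set cs. 0 \<le> t \<and> v \<in> corners"
    and sum: "sum_list (map fst cs) = 1"
    and eq: "p = (\<Sum>(t, v)\<leftarrow>cs. t *\<^sub>R v)"
  shows "p \<in> corners"
proof -
  let ?I = "{0..<length cs}" and ?t = "\<lambda>i. fst (cs ! i)" and ?v = "\<lambda>i. snd (cs ! i)"
  have v: "0 \<le> ?t i" "?v i \<in> corners" if "i \<in> ?I" for i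
    using cs that by (auto simp: case_prod_beta)
  then have "?v i \<in> qutrit_set" if "i \<in> ?I" for i
    using that corner_extreme extreme_point_of_qutrit_setD by blast
  moreover have "sum ?t ?I = 1" "p = (\<Sum>i\<in>?I. ?t i *\<^sub>R ?v i)"
    using sum eq by (simp_all add: sum_list_sum_nth case_prod_beta)
  ultimately have "p \<in> ?v ` ?I"
    using v(1) by (intro extreme_point_of_convex_combination[OF p convex_qutrit_set, of ?I ?t]) auto
  then show ?thesis using v(2) by auto
qed

text \<open>The facet cut out by a single rule is a simplex, and its barycentric coordinates are multiples
  of slacks of other inequalities of the system.\<close>

lemma extreme_on_facet_1:
  assumes p: "p extreme_point_of qutrit_set" and tight: "slack (rules ! 0) 1 2 3 p = 0"
  shows "p \<in> corners"
proof (rule extreme_of_corner_combination[OF p])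
  \<comment> \<open>In (1) to (6) the rows \<open>a\<close> and \<open>c\<close> carry the same
    functional, and that of row \<open>b\<close> vanishes at \<open>O\<close>. Hence [t, O, t] is
    tight for every row t, which puts [O, O, O], [A, O, A] and [B, O, B] on these six facets. Each
    weight is 1 at its own corner and 0 at the other five.\<close>
  let ?cs = "[(p$1$3 - p$1$2, vector [triple_O, triple_O, triple_O]),
    (2 * slack (rules ! 4) 1 3 2 p, vector [triple_A, triple_O, triple_A]),
    (2 * slack (rules ! 4) 1 2 3 p, vector [triple_A, triple_A, triple_O]),
    (3 * p$3$1, vector [triple_B, triple_O, triple_B]),
    (3 * slack (rules ! 3) 1 2 3 p, vector [triple_B, vector [0, 1/3, 2/3], vector [0, 1/3, 2/3]]),
    (3 * p$2$1, vector [triple_B, triple_B, triple_O])]"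
  show "\<forall>(t, v)\<in>set ?cs. 0 \<le> t \<and> v \<in> corners"
    using extreme_point_of_qutrit_setD[OF p]
    by (simp add: rule_slack_nonneg qutrit_set_row corner_intros)
  show "sum_list (map fst ?cs) = 1"
    using tight qutrit_set_row_sum[OF extreme_point_of_qutrit_setD[OF p]]
    by (simp add: slack_def rules_def inner_3; linarith)
  \<comment> \<open>Modulo the row sums and the tight equation, both sides agree as affine functions
    in each of the nine entries.\<close>
  show "p = (\<Sum>(t, v)\<leftarrow>?cs. t *\<^sub>R v)"
    using tight qutrit_set_row_sum[OF extreme_point_of_qutrit_setD[OF p]]
    by (simp add: slack_def rules_def inner_3 vec_eq_iff forall_3 triple_defs; intro conjI; argo)
qed

lemma extreme_on_facet_2:
  assumes p: "p extreme_point_of qutrit_set" and tight: "slack (rules ! 1) 1 2 3 p = 0"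
  shows "p \<in> corners"
proof (rule extreme_of_corner_combination[OF p])
  let ?cs = "[(p$3$3 - p$3$2, vector [triple_O, triple_O, triple_O]),
    (2 * slack (rules ! 5) 3 2 1 p, vector [triple_O, triple_A, triple_A]),
    (2 * (p$1$2 - p$1$1), vector [triple_A, triple_O, triple_A]),
    (6 * p$2$1, vector [vector [1/6, 1/6, 2/3], vector [1/6, 1/6, 2/3], triple_A]),
    (4 * slack (rules ! 3) 3 1 2 p, vector [vector [1/4, 1/4, 1/2], vector [0, 1/4, 3/4], triple_A]),
    (3 * p$3$1, vector [triple_B, triple_O, triple_B])]"
  show "\<forall>(t, v)\<in>set ?cs. 0 \<le> t \<and> v \<in> corners"
    using extreme_point_of_qutrit_setD[OF p]
    by (simp add: rule_slack_nonneg qutrit_set_row corner_intros)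
  show "sum_list (map fst ?cs) = 1"
    using tight qutrit_set_row_sum[OF extreme_point_of_qutrit_setD[OF p]]
    by (simp add: slack_def rules_def inner_3; linarith)
  show "p = (\<Sum>(t, v)\<leftarrow>?cs. t *\<^sub>R v)"
    using tight qutrit_set_row_sum[OF extreme_point_of_qutrit_setD[OF p]]
    by (simp add: slack_def rules_def inner_3 vec_eq_iff forall_3 triple_defs; intro conjI; argo)
qed

lemma extreme_on_facet_3:
  assumes p: "p extreme_point_of qutrit_set" and tight: "slack (rules ! 2) 1 2 3 p = 0"
  shows "p \<in> corners"
proof (rule extreme_of_corner_combination[OF p])
  \<comment> \<open>Inequality (7) supplies the weight of [O, O, O], the only corner of this facet
    at which it is not tight.\<close>
  let ?cs = "[(slack (rules ! 6) 1 2 3 p, vector [triple_O, triple_O, triple_O]),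
    (3 * slack (rules ! 5) 1 2 3 p, vector [vector [0, 1/3, 2/3], vector [0, 1/3, 2/3], triple_B]),
    (2 * (p$3$2 - p$3$1), vector [triple_A, triple_O, triple_A]),
    (4 * slack (rules ! 4) 3 2 1 p, vector [triple_A, vector [0, 1/4, 3/4], vector [1/4, 1/4, 1/2]]),
    (6 * p$2$1, vector [triple_A, vector [1/6, 1/6, 2/3], triple_B]),
    (3 * p$1$1, vector [triple_B, triple_O, triple_B])]"
  show "\<forall>(t, v)\<in>set ?cs. 0 \<le> t \<and> v \<in> corners"
    using extreme_point_of_qutrit_setD[OF p]
    by (simp add: rule_slack_nonneg qutrit_set_row corner_intros)
  show "sum_list (map fst ?cs) = 1"
    using tight qutrit_set_row_sum[OF extreme_point_of_qutrit_setD[OF p]]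
    by (simp add: slack_def rules_def inner_3; linarith)
  show "p = (\<Sum>(t, v)\<leftarrow>?cs. t *\<^sub>R v)"
    using tight qutrit_set_row_sum[OF extreme_point_of_qutrit_setD[OF p]]
    by (simp add: slack_def rules_def inner_3 vec_eq_iff forall_3 triple_defs; intro conjI; argo)
qed

lemma extreme_on_facet_4:
  assumes p: "p extreme_point_of qutrit_set" and tight: "slack (rules ! 3) 1 2 3 p = 0"
  shows "p \<in> corners"
proof (rule extreme_of_corner_combination[OF p])
  \<comment> \<open>Five of these corners also lie on the facet of (1), so the slack of (1) is the
    weight, up to scaling, of the sixth.\<close>
  let ?cs = "[(p$1$3 - p$1$2, vector [triple_O, triple_O, triple_O]),
    (2 * (p$3$2 - p$3$1), vector [triple_A, triple_O, triple_A]),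
    (2 * (p$2$2 - p$2$1), vector [triple_A, triple_A, triple_O]),
    (6 * slack (rules ! 0) 1 2 3 p, vector [triple_A, vector [1/6, 1/6, 2/3], vector [1/6, 1/6, 2/3]]),
    (3 * slack (rules ! 1) 2 3 1 p, vector [triple_B, triple_O, triple_B]),
    (3 * slack (rules ! 1) 3 2 1 p, vector [triple_B, triple_B, triple_O])]"
  show "\<forall>(t, v)\<in>set ?cs. 0 \<le> t \<and> v \<in> corners"
    using extreme_point_of_qutrit_setD[OF p]
    by (simp add: rule_slack_nonneg qutrit_set_row corner_intros)
  show "sum_list (map fst ?cs) = 1"
    using tight qutrit_set_row_sum[OF extreme_point_of_qutrit_setD[OF p]]
    by (simp add: slack_def rules_def inner_3; linarith)
  show "p = (\<Sum>(t, v)\<leftarrow>?cs. t *\<^sub>R v)"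
    using tight qutrit_set_row_sum[OF extreme_point_of_qutrit_setD[OF p]]
    by (simp add: slack_def rules_def inner_3 vec_eq_iff forall_3 triple_defs; intro conjI; argo)
qed

lemma extreme_on_facet_5:
  assumes p: "p extreme_point_of qutrit_set" and tight: "slack (rules ! 4) 1 2 3 p = 0"
  shows "p \<in> corners"
proof (rule extreme_of_corner_combination[OF p])
  let ?cs = "[(p$1$3 - p$1$2, vector [triple_O, triple_O, triple_O]),
    (2 * (p$1$2 - p$1$1), vector [triple_A, triple_O, triple_A]),
    (3 * p$3$1, vector [triple_B, triple_O, triple_B]),
    (3 * (p$2$2 - p$2$1), vector [triple_B, vector [0, 1/3, 2/3], vector [0, 1/3, 2/3]]),
    (6 * slack (rules ! 0) 1 2 3 p, vector [triple_B, vector [1/6, 1/6, 2/3], triple_A]),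
    (3 * slack (rules ! 2) 3 2 1 p, vector [triple_B, triple_B, triple_O])]"
  show "\<forall>(t, v)\<in>set ?cs. 0 \<le> t \<and> v \<in> corners"
    using extreme_point_of_qutrit_setD[OF p]
    by (simp add: rule_slack_nonneg qutrit_set_row corner_intros)
  show "sum_list (map fst ?cs) = 1"
    using tight qutrit_set_row_sum[OF extreme_point_of_qutrit_setD[OF p]]
    by (simp add: slack_def rules_def inner_3; linarith)
  show "p = (\<Sum>(t, v)\<leftarrow>?cs. t *\<^sub>R v)"
    using tight qutrit_set_row_sum[OF extreme_point_of_qutrit_setD[OF p]]
    by (simp add: slack_def rules_def inner_3 vec_eq_iff forall_3 triple_defs; intro conjI; argo)
qed

lemma extreme_on_facet_6:
  assumes p: "p extreme_point_of qutrit_set" and tight: "slack (rules ! 5) 1 2 3 p = 0"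
  shows "p \<in> corners"
proof (rule extreme_of_corner_combination[OF p])
  let ?cs = "[(p$1$3 - p$1$2, vector [triple_O, triple_O, triple_O]),
    (2 * (p$3$2 - p$3$1), vector [triple_A, triple_O, triple_A]),
    (4 * (p$2$2 - p$2$1), vector [triple_A, vector [0, 1/4, 3/4], vector [1/4, 1/4, 1/2]]),
    (6 * slack (rules ! 2) 1 2 3 p, vector [triple_A, vector [1/6, 1/6, 2/3], vector [1/6, 1/6, 2/3]]),
    (6 * slack (rules ! 1) 3 2 1 p, vector [triple_A, vector [1/6, 1/6, 2/3], triple_B]),
    (3 * p$1$1, vector [triple_B, triple_O, triple_B])]"
  show "\<forall>(t, v)\<in>set ?cs. 0 \<le> t \<and> v \<in> corners"
    using extreme_point_of_qutrit_setD[OF p]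
    by (simp add: rule_slack_nonneg qutrit_set_row corner_intros)
  show "sum_list (map fst ?cs) = 1"
    using tight qutrit_set_row_sum[OF extreme_point_of_qutrit_setD[OF p]]
    by (simp add: slack_def rules_def inner_3; linarith)
  show "p = (\<Sum>(t, v)\<leftarrow>?cs. t *\<^sub>R v)"
    using tight qutrit_set_row_sum[OF extreme_point_of_qutrit_setD[OF p]]
    by (simp add: slack_def rules_def inner_3 vec_eq_iff forall_3 triple_defs; intro conjI; argo)
qed

text \<open>Rows \<open>a\<close> and \<open>c\<close> carry different functionals in (7), and
  [O, O, O] is not tight. Compared with the facet of (3), it is replaced by [A, A, B], whose weight
  is the scaled slack of (3).\<close>

lemma extreme_on_facet_7:
  assumes p: "p extreme_point_of qutrit_set" and tight: "slack (rules ! 6) 1 2 3 p = 0"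
  shows "p \<in> corners"
proof (rule extreme_of_corner_combination[OF p])
  let ?cs = "[(3 * (p$1$3 - p$1$2), vector [vector [0, 1/3, 2/3], vector [0, 1/3, 2/3], triple_B]),
    (2 * (p$3$2 - p$3$1), vector [triple_A, triple_O, triple_A]),
    (4 * (p$3$3 - p$3$2), vector [triple_A, vector [0, 1/4, 3/4], vector [1/4, 1/4, 1/2]]),
    (6 * slack (rules ! 2) 1 2 3 p, vector [triple_A, triple_A, triple_B]),
    (6 * p$2$1, vector [triple_A, vector [1/6, 1/6, 2/3], triple_B]),
    (3 * p$1$1, vector [triple_B, triple_O, triple_B])]"
  show "\<forall>(t, v)\<in>set ?cs. 0 \<le> t \<and> v \<in> corners"
    using extreme_point_of_qutrit_setD[OF p]
    by (simp add: rule_slack_nonneg qutrit_set_row corner_intros)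
  show "sum_list (map fst ?cs) = 1"
    using tight qutrit_set_row_sum[OF extreme_point_of_qutrit_setD[OF p]]
    by (simp add: slack_def rules_def inner_3; linarith)
  show "p = (\<Sum>(t, v)\<leftarrow>?cs. t *\<^sub>R v)"
    using tight qutrit_set_row_sum[OF extreme_point_of_qutrit_setD[OF p]]
    by (simp add: slack_def rules_def inner_3 vec_eq_iff forall_3 triple_defs; intro conjI; argo)
qed

text \<open>Symmetry moves the tight inequality to the indices 1, 2, 3, where one of the seven
  facets applies; the inverse permutation brings the corner back.\<close>

lemma extreme_with_tight_rule:
  assumes p: "p extreme_point_of qutrit_set" and w: "w \<in> set rules"
    and abc: "distinct [a, b, c]" and tight: "slack w a b c p = 0"
  shows "p \<in> corners"
proof -
  obtain \<sigma> where \<sigma>: "\<sigma> permutes UNIV" "\<sigma> 1 = a" "\<sigma> 2 = b" "\<sigma> 3 = c"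
    using ex_permutation_3[OF abc] .
  let ?q = "permute_qutrits \<sigma> p"
  have q: "?q extreme_point_of qutrit_set"
    using \<sigma>(1) p by (rule extreme_permute_qutrits)
  obtain i where i: "i < 7" "w = rules ! i"
    using w length_rules unfolding in_set_conv_nth by metis
  have "slack (rules ! i) 1 2 3 ?q = 0"
    using tight \<sigma> i by (simp add: slack_permute_qutrits)
  moreover have "i \<in> {0, 1, 2, 3, 4, 5, 6}" using i(1) by auto
  ultimately have "?q \<in> corners"
    using extreme_on_facet_1[OF q] extreme_on_facet_2[OF q] extreme_on_facet_3[OF q]
      extreme_on_facet_4[OF q] extreme_on_facet_5[OF q] extreme_on_facet_6[OF q]
      extreme_on_facet_7[OF q] by auto
  then have "permute_qutrits (inv \<sigma>) ?q \<in> corners"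
    using \<sigma>(1) by (simp add: permute_qutrits_in_corners permutes_inv)
  then show ?thesis using \<sigma>(1) by (simp add: permute_qutrits_inv)
qed

lemma vector_3_eta: "l = vector [l $ 1, l $ 2, l $ 3]" for l :: "'a::zero ^ 3"
  by (simp add: vec_eq_iff forall_3)

text \<open>The excluded points \<open>[O, O, A]\<close>, \<open>[O, O, B]\<close> and \<open>[O, A, B]\<close> violate inequality (1).\<close>

lemma corner_if_rows_extreme:
  assumes p: "p \<in> qutrit_set" and rows: "\<And>a. p $ a \<in> {triple_O, triple_A, triple_B}"
  shows "p \<in> corners"
proof -
  have "0 \<le> slack (rules ! 0) 1 2 3 p" "0 \<le> slack (rules ! 0) 2 1 3 p"
    "0 \<le> slack (rules ! 0) 3 1 2 p"
    using p by (simp_all add: rule_slack_nonneg)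
  note ineqs = this[unfolded slack_def rules_def inner_3, simplified]
  \<comment> \<open>Only entries are evaluated: unfolding the triples themselves would destroy the
    patterns of \<open>corner_intros\<close>.\<close>
  have nth: "triple_O $ 1 = 0" "triple_O $ 2 = 0" "triple_A $ 1 = 0" "triple_A $ 2 = 1/2"
    "triple_B $ 1 = 1/3" "triple_B $ 2 = 1/3"
    by (simp_all add: triple_defs)
  \<comment> \<open>Of the 27 choices of rows, each is either refuted by (1) or an arrangement of a
    listed point.\<close>
  have "vector [p $ 1, p $ 2, p $ 3] \<in> corners"
    using ineqs rows[of 1] rows[of 2] rows[of 3] unfolding insert_iff empty_iff simp_thms
    by (elim disjE; simp add: nth corner_intros)
  then show ?thesis by (simp flip: vector_3_eta)
qed

lemma extreme_points_of_qutrit_set: "{p. p extreme_point_of qutrit_set} = corners"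
proof (intro equalityI subsetI CollectI corner_extreme)
  fix p assume "p \<in> {p. p extreme_point_of qutrit_set}"
  then have p: "p extreme_point_of qutrit_set" by simp
  show "p \<in> corners"
  proof (cases "\<forall>w\<in>set rules. \<forall>a b c. distinct [a, b, c] \<longrightarrow> slack w a b c p \<noteq> 0")
    case True
    then have "p $ a \<in> {triple_O, triple_A, triple_B}" for a
      using p by (intro extreme_without_tight_rule) blast+
    then show ?thesis
      using p by (intro corner_if_rows_extreme extreme_point_of_qutrit_setD)
  next
    case False
    then show ?thesis using extreme_with_tight_rule[OF p] by blast
  qed
qed

section \<open>Projection to the six coordinates\<close>

lemma linear_coords: "linear coords"
  by (rule linearI) (simp_all add: coords_def vec_eq_iff forall_2)

lemma inj_on_coords: "inj_on coords qutrit_set"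
proof (rule inj_onI)
  fix x y assume xy: "x \<in> qutrit_set" "y \<in> qutrit_set" and "coords x = coords y"
  then have "x $ a $ 1 = y $ a $ 1" "x $ a $ 2 = y $ a $ 2" for a
    by (simp_all add: coords_def vec_eq_iff forall_2)
  then show "x = y"
    using qutrit_set_row_sum[OF xy(1)] qutrit_set_row_sum[OF xy(2)]
    by (simp add: vec_eq_iff forall_3)
qed

theorem theorem2:
  shows "{v. v extreme_point_of (coords ` qutrit_set)} =
         coords ` {permute_qutrits \<sigma> x | \<sigma> x. \<sigma> permutes UNIV \<and> x \<in> listed_points}"
  \<comment> \<open>After these rewrites the claim is that \<open>coords\<close>, linear and
    injective on the convex polytope, carries its extreme points exactly to those of the
    image.\<close>
  unfolding corners_def[symmetric] extreme_points_of_qutrit_set[symmetric]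
  by (rule extreme_points_of_image_inj_on[OF linear_coords convex_qutrit_set inj_on_coords])

end
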